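(* Let $R=M_n(K)$ and let $\mathscr{R}\colon R=R_1+\cdots+R_l$ be a decomposition of $R$ as a (not necessarily direct) sum of vector subspaces satisfying: (i) $R_i\neq 0$ for all $1\le i\le l$; (ii) for all $1\le i,j\le l$ there exists a root of unity $\theta(i,j)\in K^*$ such that $a_ia_j=\theta(i,j)a_ja_i$ for all $a_i\in R_i$ and $a_j\in R_j$. Then: (a) If the sum $\mathscr{R}$ is direct, then $l=n^2$ and $\mathscr{R}$ is a regular group grading by a finite abelian group. (b) If the sum $\mathscr{R}$ is not direct, then there exists a subset $\{i_1,\dots,i_q\}$ of $\{1,\dots,l\}$ such that: (b.1) for every $j\in\{1,\dots,l\}\setminus\{i_1,\dots,i_q\}$ one has $R_j=R_{i_k}$ for some $1\le k\le q$; (b.2) $\mathscr{R}'\colon R=R_{i_1}\oplus\cdots\oplus R_{i_q}$, $q=n^2$, and $\mathscr{R}'$ is a regular group grading by a finite abelian group. Moreover, in each case, if $\mathcal{P}:=(\theta(i,j))_{1\le i,j\le l}$ and $\mathcal{P}_1,\dots,\mathcal{P}_l$ denote the rows of $\mathcal{P}$, then $$n^2=\dim R=\#\{\mathcal{P}_1,\dots,\mathcal{P}_l\}.$$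
   Context: $K$ is an algebraically closed field of characteristic different from $2$. A direct sum decomposition $R=\bigoplus_{s\in S}R_s$ of an algebra $R$ is a regular group grading by a finite abelian group $G$ if its index set $S$ can be identified with $G$ so that $R_gR_h\subseteq R_{gh}$ for all $g,h\in G$, and: (1) for every $N\in\mathbb{N}$ and every $(g_1,\dots,g_N)\in G^N$ there exist $a_i\in R_{g_i}$ with $a_1\cdots a_N\neq 0$; (2) for all $g,h\in G$ there is a scalar $\beta(g,h)\in K^*$ such that $ab=\beta(g,h)ba$ for all $a\in R_g$, $b\in R_h$. The symbol $\#$ denotes the number of distinct elements. *)

theory Defs
  imports "HOL-Algebra.Group" "HOL-Analysis.Analysis" "HOL-Computational_Algebra.Computational_Algebra"
begin

(* The algebra M_n(K) is the type 'k ^ 'n ^ 'n with n = CARD('n). Its product is ( ** ) and its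
   unit is mat 1; the type class operation ( * ) on vectors is componentwise and is not used. *)

definition mat_smult :: "'k::field \<Rightarrow> 'k ^ 'n ^ 'm \<Rightarrow> 'k ^ 'n ^ 'm" where
  "mat_smult c A = (\<chi> i j. c * A $ i $ j)"

global_interpretation mat_space:
  vector_space "mat_smult :: 'k::field \<Rightarrow> 'k ^ 'n ^ 'm \<Rightarrow> 'k ^ 'n ^ 'm"
  by unfold_locales (simp_all add: mat_smult_def vec_eq_iff algebra_simps)

(* M_n(K) is the sum, not necessarily direct, of the subspaces R i for i in S. *)
definition sum_decomposition :: "'i set \<Rightarrow> ('i \<Rightarrow> ('k::field ^ 'n ^ 'n) set) \<Rightarrow> bool" where
  "sum_decomposition S R \<longleftrightarrow>
     finite S \<and> (\<forall>i\<in>S. mat_space.subspace (R i)) \<and>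
     (\<forall>A. \<exists>a. (\<forall>i\<in>S. a i \<in> R i) \<and> A = (\<Sum>i\<in>S. a i))"

definition direct_family :: "'i set \<Rightarrow> ('i \<Rightarrow> ('k::field ^ 'n ^ 'n) set) \<Rightarrow> bool" where
  "direct_family S R \<longleftrightarrow>
     (\<forall>a b. (\<forall>i\<in>S. a i \<in> R i) \<longrightarrow> (\<forall>i\<in>S. b i \<in> R i) \<longrightarrow>
        (\<Sum>i\<in>S. a i) = (\<Sum>i\<in>S. b i) \<longrightarrow> (\<forall>i\<in>S. a i = b i))"

definition direct_sum_decomposition ::
    "'i set \<Rightarrow> ('i \<Rightarrow> ('k::field ^ 'n ^ 'n) set) \<Rightarrow> bool" where
  "direct_sum_decomposition S R \<longleftrightarrow> sum_decomposition S R \<and> direct_family S R"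

definition regular_grading ::
    "'g monoid \<Rightarrow> ('g \<Rightarrow> ('k::field ^ 'n ^ 'n) set) \<Rightarrow> bool" where
  "regular_grading G C \<longleftrightarrow>
     direct_sum_decomposition (carrier G) C \<and>
     (\<forall>g\<in>carrier G. \<forall>h\<in>carrier G. \<forall>a\<in>C g. \<forall>b\<in>C h. a ** b \<in> C (g \<otimes>\<^bsub>G\<^esub> h)) \<and>
     (\<forall>gs. set gs \<subseteq> carrier G \<longrightarrow>
        (\<exists>as. list_all2 (\<lambda>a g. a \<in> C g) as gs \<and> foldr (**) as (mat 1) \<noteq> 0)) \<and>
     (\<forall>g\<in>carrier G. \<forall>h\<in>carrier G. \<exists>\<beta>. \<beta> \<noteq> 0 \<and>
        (\<forall>a\<in>C g. \<forall>b\<in>C h. a ** b = mat_smult \<beta> (b ** a)))"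

(* The family R over S is a regular grading by some finite abelian group G, the index set S being
   identified with G through a bijection. The elements of G may be taken in the index type without
   loss of generality, since the group structure can be transported to S. *)
definition is_regular_group_grading ::
    "'i set \<Rightarrow> ('i \<Rightarrow> ('k::field ^ 'n ^ 'n) set) \<Rightarrow> bool" where
  "is_regular_group_grading S R \<longleftrightarrow>
     (\<exists>(G :: 'i monoid) \<psi>. comm_group G \<and> finite (carrier G) \<and>
        bij_betw \<psi> (carrier G) S \<and> regular_grading G (\<lambda>g. R (\<psi> g)))"

end

theory Submission
  imports Defs
begin

text \<open>
  Every nonzero element \<open>a\<close> of a component is invertible: \<open>a\<close> commutes up to a scalar with
  each component, hence \<open>a ** M\<close> is a left multiple of \<open>a\<close> for every matrix \<open>M\<close>, so the kernel of
  \<open>a\<close> is stable under all matrices, and a kernel stable under all matrices is zero or everything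
  (\<open>invertible_if_right_ideal_in_left_ideal\<close>).

  Conjugation by nonzero elements of the components is therefore a family of commuting
  diagonalisable operators on the matrix algebra, and the rows of \<open>\<theta>\<close> are their simultaneous
  eigenvalues. Two elements of the same eigenvalue system differ by a central factor, that is, by a
  scalar; so the components are exactly the simultaneous eigenspaces, each of dimension one
  (\<open>component_iff_character\<close>), and two components coincide precisely when their rows do
  (\<open>component_eq_iff_row_eq\<close>).

  Eigenvectors for different eigenvalue systems are linearly independent
  (\<open>homogeneous_independent\<close>). Hence the distinct components form a direct sum of lines, and there
  are as many of them as the dimension of the algebra (\<open>card_index\<close>). Each nonzero simultaneous
  eigenvector lies in a component (\<open>character_occurs\<close>). Applied to products, to the unit matrix
  and to inverses, this says that the components multiply like a group; it is abelian because \<open>ab\<close>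
  and \<open>ba\<close> span the same line, and the grading is regular because products of invertible matrices
  are nonzero.

  In a direct decomposition the components are distinct. In a general one, one index is kept for
  each distinct component, which loses nothing as each component is closed under addition.
\<close>

no_notation fps_nth (infixl \<open>$\<close> 75)

section \<open>Matrix algebra\<close>

lemma smult_matrix_mult: "mat_smult c A ** B = mat_smult c (A ** B)"
  by (simp add: vec_eq_iff mat_smult_def matrix_matrix_mult_def sum_distrib_left mult.assoc)

lemma matrix_mult_smult: "A ** mat_smult c B = mat_smult c (A ** B)"
  by (simp add: vec_eq_iff mat_smult_def matrix_matrix_mult_def sum_distrib_left mult.left_commute)

lemma matrix_mult_zero_left: "0 ** A = (0 :: 'k::field ^ 'n ^ 'm)"
  by (simp add: vec_eq_iff matrix_matrix_mult_def)

lemma matrix_mult_zero_right: "A ** 0 = (0 :: 'k::field ^ 'n ^ 'm)"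
  by (simp add: vec_eq_iff matrix_matrix_mult_def)

lemma matrix_add_mult: "(A + B) ** C = A ** C + B ** (C :: 'k::field ^ 'n ^ 'm)"
  by (simp add: vec_eq_iff matrix_matrix_mult_def distrib_right sum.distrib)

lemma sum_matrix_mult: "(\<Sum>i\<in>I. f i) ** (B :: 'k::field ^ 'n ^ 'm) = (\<Sum>i\<in>I. f i ** B)"
  by (induction I rule: infinite_finite_induct)
     (simp_all add: matrix_mult_zero_left matrix_add_mult)

lemma matrix_mult_sum: "(B :: 'k::field ^ 'n ^ 'm) ** (\<Sum>i\<in>I. f i) = (\<Sum>i\<in>I. B ** f i)"
  by (induction I rule: infinite_finite_induct)
     (simp_all add: matrix_mult_zero_right matrix_add_ldistrib)

lemma invertible_nonzero: "invertible A \<Longrightarrow> A \<noteq> (0 :: 'k::field ^ 'n ^ 'n)"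
proof
  assume "invertible A" "A = 0"
  then have "(0 :: 'k ^ 'n ^ 'n) = mat 1"
    by (auto simp: invertible_def matrix_mult_zero_left)
  then have "(0 :: 'k ^ 'n ^ 'n) $ i $ i = mat 1 $ i $ i" for i
    by simp
  then show False
    by (simp add: mat_def)
qed

lemma invertible_matrix_mult_left_cancel:
  fixes C :: "'k::field ^ 'n ^ 'n"
  assumes "invertible C" and eq: "C ** X = C ** Y"
  shows "X = Y"
proof -
  obtain D where D: "D ** C = mat 1"
    using assms(1) by (auto simp: invertible_def)
  have "D ** (C ** X) = D ** (C ** Y)"
    by (simp only: eq)
  then show ?thesis
    by (simp add: matrix_mul_assoc D)
qed

lemma invertible_foldr_mult:
  fixes as :: "('k::field ^ 'n ^ 'n) list"
  assumes "\<And>a. a \<in> set as \<Longrightarrow> invertible a"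
  shows "invertible (foldr (**) as (mat 1))"
  using assms
  by (induction as) (auto intro: invertible_mult simp: invertible_def[of "mat 1"])

text \<open>
  If \<open>A *v v = 0\<close> then \<open>A *v (M *v v) = N *v (A *v v) = 0\<close> for all \<open>M\<close>, and for \<open>v \<noteq> 0\<close> the vectors
  \<open>M *v v\<close> exhaust the space.
\<close>

lemma invertible_if_right_ideal_in_left_ideal:
  fixes A :: "'k::field ^ 'n ^ 'n"
  assumes "A \<noteq> 0" and normal: "\<And>M. \<exists>N. A ** M = N ** A"
  shows "invertible A"
proof -
  have "v = 0" if v: "A *v v = 0" for v
  proof (rule ccontr)
    assume "v \<noteq> 0"
    then obtain q where q: "v $ q \<noteq> 0"
      by (auto simp: vec_eq_iff)
    have "A *v w = 0" for w
    proof -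
      \<comment> \<open>a rank one matrix that sends \<open>v\<close> to \<open>w\<close>\<close>
      define M :: "'k ^ 'n ^ 'n" where "M = (\<chi> i j. if j = q then w $ i / v $ q else 0)"
      have "M *v v = w"
        using q by (simp add: M_def vec_eq_iff matrix_vector_mult_def if_distrib if_distribR cong: if_cong)
      moreover obtain N where "A ** M = N ** A"
        using normal by blast
      ultimately show "A *v w = 0"
        using v by (metis matrix_vector_mul_assoc matrix_vector_mult_0_right)
    qed
    then have "A = 0"
      by (subst matrix_eq) simp
    with \<open>A \<noteq> 0\<close> show False
      by blast
  qed
  then show ?thesis
    by (simp add: invertible_left_inverse matrix_left_invertible_ker)
qed

definition matrix_unit :: "'n \<Rightarrow> 'n \<Rightarrow> 'k::field ^ 'n ^ 'n" where
  "matrix_unit p q = (\<chi> i j. if i = p \<and> j = q then 1 else 0)"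

lemma matrix_mult_unit_nth: "(A ** matrix_unit p q) $ i $ j = (if j = q then A $ i $ p else 0)"
  by (cases "j = q") (simp_all add: matrix_matrix_mult_def matrix_unit_def if_distrib cong: if_cong)

lemma unit_matrix_mult_nth: "(matrix_unit p q ** A) $ i $ j = (if i = p then A $ q $ j else 0)"
  by (cases "i = p")
     (simp_all add: matrix_matrix_mult_def matrix_unit_def if_distrib if_distribR cong: if_cong)

text \<open>
  Commuting with the matrix units forces the off-diagonal entries to vanish and the diagonal
  entries to agree.
\<close>

lemma central_matrix_scalar:
  fixes C :: "'k::field ^ 'n ^ 'n"
  assumes central: "\<And>M. C ** M = M ** C"
  obtains c where "C = mat_smult c (mat 1)"
proof -
  have entry: "C $ i $ p = (if i = p then C $ q $ q else 0)" for i p q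
  proof -
    have "(C ** matrix_unit p q) $ i $ q = (matrix_unit p q ** C) $ i $ q"
      using central by simp
    then show ?thesis
      by (simp add: matrix_mult_unit_nth unit_matrix_mult_nth)
  qed
  obtain q :: 'n where True
    by blast
  have "C $ i $ j = mat_smult (C $ q $ q) (mat 1) $ i $ j" for i j
    by (subst entry[of i j q]) (simp add: mat_smult_def mat_def)
  then have "C = mat_smult (C $ q $ q) (mat 1)"
    unfolding vec_eq_iff by blast
  then show thesis
    by (rule that)
qed

lemma matrix_unit_expansion:
  fixes A :: "'k::field ^ 'n::finite ^ 'n"
  shows "A = (\<Sum>(p, q)\<in>UNIV. mat_smult (A $ p $ q) (matrix_unit p q))"
    (is "A = ?S")
proof -
  have "?S $ i $ j = A $ i $ j" for i j
  proof -
    have "?S $ i $ j = (\<Sum>z\<in>UNIV. if z = (i, j) then A $ i $ j else 0)"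
      unfolding sum_component by (rule sum.cong) (auto simp: mat_smult_def matrix_unit_def split: if_splits)
    then show ?thesis
      by simp
  qed
  then show ?thesis
    by (simp add: vec_eq_iff)
qed

lemma dim_matrix_space: "mat_space.dim (UNIV :: ('k::field ^ 'n::finite ^ 'n) set) = CARD('n)\<^sup>2"
proof (rule mat_space.dim_unique)
  let ?e = "\<lambda>(p, q). matrix_unit p q :: 'k ^ 'n ^ 'n"
  have inj: "inj ?e"
  proof (rule injI)
    fix z z' assume "?e z = ?e z'"
    then have "?e z $ fst z $ snd z = ?e z' $ fst z $ snd z"
      by simp
    then show "z = z'"
      by (auto simp: matrix_unit_def split: prod.splits if_splits)
  qed
  show "range ?e \<subseteq> UNIV"
    by simp
  show "UNIV \<subseteq> mat_space.span (range ?e)"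
  proof
    fix A :: "'k ^ 'n ^ 'n"
    have "(\<Sum>(p, q)\<in>UNIV. mat_smult (A $ p $ q) (matrix_unit p q)) \<in> mat_space.span (range ?e)"
      unfolding case_prod_unfold
      by (intro mat_space.span_sum mat_space.span_scale mat_space.span_base rev_image_eqI) simp_all
    then show "A \<in> mat_space.span (range ?e)"
      using matrix_unit_expansion[of A] by simp
  qed
  show "mat_space.independent (range ?e)"
  proof (rule mat_space.independent_if_scalars_zero)
    fix f and x :: "'k ^ 'n ^ 'n"
    assume 0: "(\<Sum>x\<in>range ?e. mat_smult (f x) x) = 0" and "x \<in> range ?e"
    then obtain i j where x: "x = matrix_unit i j"
      by auto
    define A :: "'k ^ 'n ^ 'n" where "A = (\<chi> p q. f (matrix_unit p q))"
    have "0 = (\<Sum>z\<in>UNIV. mat_smult (f (?e z)) (?e z))"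
      using 0 inj by (simp add: sum.reindex)
    also have "\<dots> = A"
      using matrix_unit_expansion[of A] by (simp add: A_def case_prod_unfold)
    finally show "f x = 0"
      by (simp add: x A_def vec_eq_iff)
  qed simp
  show "card (range ?e) = CARD('n)\<^sup>2"
    using inj by (simp add: card_image power2_eq_square)
qed

section \<open>Decompositions whose components commute up to scalars\<close>

locale colour_decomposition =
  fixes S :: "'i set" and R :: "'i \<Rightarrow> ('k::field ^ 'n::finite ^ 'n) set" and \<theta> :: "'i \<Rightarrow> 'i \<Rightarrow> 'k"
  assumes decomp: "sum_decomposition S R"
    and nontrivial: "i \<in> S \<Longrightarrow> R i \<noteq> {0}"
    and theta_nonzero: "i \<in> S \<Longrightarrow> j \<in> S \<Longrightarrow> \<theta> i j \<noteq> 0"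
    and comm: "i \<in> S \<Longrightarrow> j \<in> S \<Longrightarrow> a \<in> R i \<Longrightarrow> b \<in> R j \<Longrightarrow> a ** b = mat_smult (\<theta> i j) (b ** a)"
begin

lemma finite_index: "finite S"
  using decomp by (simp add: sum_decomposition_def)

lemma subspace_component: "i \<in> S \<Longrightarrow> mat_space.subspace (R i)"
  using decomp by (simp add: sum_decomposition_def)

lemma obtain_components:
  obtains a where "\<And>i. i \<in> S \<Longrightarrow> a i \<in> R i" "A = (\<Sum>i\<in>S. a i)"
  using decomp by (metis sum_decomposition_def)

lemma obtain_nonzero:
  assumes "i \<in> S"
  obtains a where "a \<in> R i" "a \<noteq> 0"
  using nontrivial[OF assms] mat_space.subspace_0[OF subspace_component[OF assms]] by blast

text \<open>
  Moving \<open>a\<close> past \<open>M = (\<Sum>j\<in>S. m j)\<close> multiplies the summand \<open>m j\<close> by \<open>\<theta> i j\<close>, so \<open>a ** M\<close> is again of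
  the form \<open>N ** a\<close>.
\<close>

lemma homogeneous_invertible:
  assumes i: "i \<in> S" and a: "a \<in> R i" "a \<noteq> 0"
  shows "invertible a"
proof (rule invertible_if_right_ideal_in_left_ideal[OF a(2)])
  fix M
  obtain m where m: "\<And>j. j \<in> S \<Longrightarrow> m j \<in> R j" "M = (\<Sum>j\<in>S. m j)"
    using obtain_components[of M] by blast
  have "a ** M = (\<Sum>j\<in>S. mat_smult (\<theta> i j) (m j)) ** a"
    unfolding m(2) matrix_mult_sum sum_matrix_mult smult_matrix_mult
    using i a m(1) by (intro sum.cong refl comm) auto
  then show "\<exists>N. a ** M = N ** a"
    by blast
qed

lemma eq_if_smult_homogeneous_eq:
  fixes B :: "'k ^ 'n ^ 'n"
  assumes "a \<in> R i" "a \<noteq> 0" "i \<in> S" "invertible B" "mat_smult c (a ** B) = mat_smult d (a ** B)"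
  shows "c = d"
proof -
  have "a ** B \<noteq> 0"
    by (rule invertible_nonzero[OF invertible_mult[OF homogeneous_invertible[OF assms(3,1,2)] assms(4)]])
  then show ?thesis
    using assms(5) by simp
qed

text \<open>
  Simultaneous eigenvectors of the conjugations by homogeneous elements, with the equation
  multiplied out so that it also makes sense for singular \<open>A\<close>.
\<close>

definition has_character :: "'k ^ 'n ^ 'n \<Rightarrow> ('i \<Rightarrow> 'k) \<Rightarrow> bool" where
  "has_character A \<alpha> \<longleftrightarrow> (\<forall>s\<in>S. \<forall>c\<in>R s. A ** c = mat_smult (\<alpha> s) (c ** A))"

lemma has_character_cong:
  "(\<And>s. s \<in> S \<Longrightarrow> \<alpha> s = \<beta> s) \<Longrightarrow> has_character A \<alpha> \<longleftrightarrow> has_character A \<beta>"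
  by (simp add: has_character_def)

lemma has_character_homogeneous: "i \<in> S \<Longrightarrow> a \<in> R i \<Longrightarrow> has_character a (\<theta> i)"
  unfolding has_character_def using comm by blast

lemma has_character_one: "has_character (mat 1) (\<lambda>_. 1)"
  by (simp add: has_character_def)

lemma has_character_mult:
  assumes "has_character A \<alpha>" "has_character B \<beta>"
  shows "has_character (A ** B) (\<lambda>s. \<alpha> s * \<beta> s)"
  unfolding has_character_def
proof (intro ballI)
  fix s c assume "s \<in> S" "c \<in> R s"
  then have A: "A ** c = mat_smult (\<alpha> s) (c ** A)" and B: "B ** c = mat_smult (\<beta> s) (c ** B)"
    using assms by (auto simp: has_character_def)
  have "(A ** B) ** c = A ** (B ** c)"
    by (simp add: matrix_mul_assoc)
  also have "\<dots> = mat_smult (\<beta> s) ((A ** c) ** B)"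
    by (simp add: B matrix_mult_smult matrix_mul_assoc)
  also have "\<dots> = mat_smult (\<alpha> s * \<beta> s) (c ** (A ** B))"
    by (simp add: A smult_matrix_mult matrix_mul_assoc mult.commute)
  finally show "A ** B ** c = mat_smult (\<alpha> s * \<beta> s) (c ** (A ** B))" .
qed

lemma has_character_inverse:
  assumes A: "has_character A \<alpha>" and AB: "A ** B = mat 1" and nz: "\<And>s. s \<in> S \<Longrightarrow> \<alpha> s \<noteq> 0"
  shows "has_character B (\<lambda>s. inverse (\<alpha> s))"
  unfolding has_character_def
proof (intro ballI)
  fix s c assume s: "s \<in> S" "c \<in> R s"
  then have Ac: "A ** c = mat_smult (\<alpha> s) (c ** A)"
    using A by (auto simp: has_character_def)
  have BA: "B ** A = mat 1"
    using AB by (simp add: matrix_left_right_inverse1)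
  have "c ** B = B ** (A ** c) ** B"
    by (simp add: BA matrix_mul_assoc)
  also have "\<dots> = mat_smult (\<alpha> s) (B ** c ** (A ** B))"
    by (simp add: Ac smult_matrix_mult matrix_mult_smult matrix_mul_assoc)
  finally have "c ** B = mat_smult (\<alpha> s) (B ** c)"
    by (simp add: AB)
  then show "B ** c = mat_smult (inverse (\<alpha> s)) (c ** B)"
    using nz[OF s(1)] by simp
qed

text \<open>
  For invertible \<open>A\<close> the products \<open>c ** A\<close> with nonzero homogeneous \<open>c\<close> do not vanish, so the scalars
  can be read off.
\<close>

lemma character_unique:
  assumes "invertible A" "has_character A \<alpha>" "has_character A \<beta>" "s \<in> S"
  shows "\<alpha> s = \<beta> s"
proof -
  obtain c where c: "c \<in> R s" "c \<noteq> 0"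
    using obtain_nonzero assms(4) by blast
  then have "mat_smult (\<alpha> s) (c ** A) = mat_smult (\<beta> s) (c ** A)"
    using assms by (metis has_character_def)
  then show ?thesis
    using c assms by (blast intro: eq_if_smult_homogeneous_eq)
qed

lemma central_if_trivial_character:
  assumes "has_character C \<alpha>" "\<And>s. s \<in> S \<Longrightarrow> \<alpha> s = 1"
  shows "C ** M = M ** C"
proof -
  obtain m where m: "\<And>j. j \<in> S \<Longrightarrow> m j \<in> R j" "M = (\<Sum>j\<in>S. m j)"
    using obtain_components[of M] by blast
  have "C ** m s = m s ** C" if s: "s \<in> S" for s
  proof -
    have "C ** m s = mat_smult (\<alpha> s) (m s ** C)"
      using assms(1) m(1) s by (auto simp: has_character_def)
    then show ?thesis
      by (simp add: assms(2)[OF s])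
  qed
  then show ?thesis
    unfolding m(2) matrix_mult_sum sum_matrix_mult by (rule sum.cong[OF refl])
qed

text \<open>
  The quotient of two matrices with the same character has trivial character, so it commutes with
  all components and thereby with everything. This is why each component is a line.
\<close>

lemma scalar_multiple_if_same_character:
  assumes i: "i \<in> S" and a: "a \<in> R i" "a \<noteq> 0" and A: "has_character A (\<theta> i)"
  obtains c where "A = mat_smult c a"
proof -
  obtain b where b: "a ** b = mat 1" "b ** a = mat 1"
    using homogeneous_invertible[OF i a] by (auto simp: invertible_def)
  have "has_character (A ** b) (\<lambda>s. \<theta> i s * inverse (\<theta> i s))"
    by (rule has_character_mult[OF A
          has_character_inverse[OF has_character_homogeneous[OF i a(1)] b(1) theta_nonzero[OF i]]])
  then have "(A ** b) ** M = M ** (A ** b)" for M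
    by (rule central_if_trivial_character) (simp add: theta_nonzero[OF i])
  then obtain c where "A ** b = mat_smult c (mat 1)"
    using central_matrix_scalar by blast
  then have "(A ** b) ** a = mat_smult c a"
    by (simp add: smult_matrix_mult)
  then have "A = mat_smult c a"
    using b(2) by (simp add: matrix_mul_assoc[symmetric])
  then show thesis
    by (rule that)
qed

text \<open>
  A component is a whole eigenspace; this is what allows membership in it to be decided by the
  scalars alone, in particular for products and inverses.
\<close>

lemma component_iff_character:
  assumes i: "i \<in> S"
  shows "A \<in> R i \<longleftrightarrow> has_character A (\<theta> i)"
proof
  assume A: "has_character A (\<theta> i)"
  obtain a where a: "a \<in> R i" "a \<noteq> 0"
    using obtain_nonzero[OF i] by blast
  then obtain c where "A = mat_smult c a"
    using scalar_multiple_if_same_character i A by blast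
  then show "A \<in> R i"
    using a(1) i by (simp add: subspace_component mat_space.subspace_scale)
qed (use i in \<open>rule has_character_homogeneous\<close>)

lemma component_eq_iff_row_eq:
  assumes i: "i \<in> S" and j: "j \<in> S"
  shows "R i = R j \<longleftrightarrow> (\<forall>s\<in>S. \<theta> i s = \<theta> j s)"
proof
  assume eq: "R i = R j"
  obtain a where a: "a \<in> R i" "a \<noteq> 0"
    using obtain_nonzero[OF i] by blast
  have "has_character a (\<theta> i)" "has_character a (\<theta> j)"
    using a eq i j by (auto intro: has_character_homogeneous)
  then show "\<forall>s\<in>S. \<theta> i s = \<theta> j s"
    using character_unique[OF homogeneous_invertible[OF i a]] by simp
next
  assume "\<forall>s\<in>S. \<theta> i s = \<theta> j s"
  then have "has_character A (\<theta> i) = has_character A (\<theta> j)" for A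
    by (intro has_character_cong) simp
  then show "R i = R j"
    using component_iff_character i j by blast
qed

lemma components_eq_if_common_element:
  assumes "i \<in> S" "j \<in> S" "a \<in> R i" "a \<in> R j" "a \<noteq> 0"
  shows "R i = R j"
  unfolding component_eq_iff_row_eq[OF assms(1,2)]
  using character_unique[OF homogeneous_invertible[OF assms(1,3,5)]
      has_character_homogeneous[OF assms(1,3)] has_character_homogeneous[OF assms(2,4)]] by simp

text \<open>
  Only the entries of \<open>\<theta>\<close> at indices in \<open>S\<close> are constrained, whence the restriction of the rows.
\<close>

lemma card_rows_eq_card_components:
  "card ((\<lambda>i. restrict (\<theta> i) S) ` S) = card (R ` S)"
proof -
  have row_eq: "restrict (\<theta> i) S = restrict (\<theta> j) S \<longleftrightarrow> R i = R j" if "i \<in> S" "j \<in> S" for i j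
    unfolding component_eq_iff_row_eq[OF that]
    by (metis (no_types, lifting) restrict_apply' restrict_ext)
  obtain T where T: "T \<subseteq> S" "inj_on R T" "R ` S = R ` T"
    using subset_image_inj[of "R ` S" R S] by auto
  have "(\<lambda>i. restrict (\<theta> i) S) ` S = (\<lambda>i. restrict (\<theta> i) S) ` T"
  proof (intro equalityI subsetI)
    fix r assume "r \<in> (\<lambda>i. restrict (\<theta> i) S) ` S"
    then obtain i where i: "i \<in> S" "r = restrict (\<theta> i) S"
      by blast
    then have "R i \<in> R ` T"
      using T(3) by (metis imageI)
    then obtain t where t: "t \<in> T" "R i = R t"
      by blast
    then have "r = restrict (\<theta> t) S"
      using i T(1) row_eq[of i t] by auto
    with t(1) show "r \<in> (\<lambda>i. restrict (\<theta> i) S) ` T"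
      by (rule rev_image_eqI)
  qed (use T(1) in blast)
  moreover have "inj_on (\<lambda>i. restrict (\<theta> i) S) T"
  proof (rule inj_onI)
    fix i j assume ij: "i \<in> T" "j \<in> T" "restrict (\<theta> i) S = restrict (\<theta> j) S"
    then have "R i = R j"
      using row_eq[of i j] T(1) by auto
    then show "i = j"
      using T(2) ij(1,2) by (simp add: inj_onD)
  qed
  ultimately show ?thesis
    using T(2,3) by (simp add: card_image)
qed

text \<open>
  A nonzero matrix in \<open>R i = R j\<close> with \<open>i \<noteq> j\<close> would have two decompositions, one supported at \<open>i\<close> and
  the other at \<open>j\<close>.
\<close>

lemma inj_on_if_direct:
  assumes direct: "direct_family S R"
  shows "inj_on R S"
proof (rule inj_onI, rule ccontr)
  fix i j assume ij: "i \<in> S" "j \<in> S" "R i = R j" "i \<noteq> j"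
  obtain a where a: "a \<in> R i" "a \<noteq> 0"
    using obtain_nonzero ij(1) by blast
  define u :: "'i \<Rightarrow> 'i \<Rightarrow> 'k ^ 'n ^ 'n" where "u k = (\<lambda>s. if s = k then a else 0)" for k
  have "\<forall>s\<in>S. u k s \<in> R s" if "k \<in> {i, j}" for k
    using that ij a mat_space.subspace_0[OF subspace_component] by (auto simp: u_def)
  moreover have "(\<Sum>s\<in>S. u i s) = (\<Sum>s\<in>S. u j s)"
    using ij finite_index by (simp add: u_def)
  ultimately have "u i i = u j i"
    using direct[unfolded direct_family_def, rule_format, of "u i" "u j" i] ij(1) by simp
  then show False
    using ij a by (simp add: u_def)
qed

section \<open>Pairwise distinct components\<close>

text \<open>
  Linear independence of simultaneous eigenvectors. Given a vanishing sum, an element \<open>c\<close> that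
  separates the rows of \<open>t\<close> and \<open>r\<close> is moved across the sum; subtracting \<open>\<theta> r s\<close> times the original
  relation removes the term at \<open>r\<close> while the term at \<open>t\<close> is multiplied by a nonzero scalar.
\<close>

lemma homogeneous_independent:
  assumes "finite T" "T \<subseteq> S" "inj_on R T" "\<And>t. t \<in> T \<Longrightarrow> a t \<in> R t" "(\<Sum>t\<in>T. a t) = 0" "t \<in> T"
  shows "a t = 0"
  using assms
proof (induction T arbitrary: a t rule: finite_induct)
  case empty
  then show ?case by simp
next
  case (insert r T)
  have vanish: "a t = 0" if t: "t \<in> T" for t
  proof -
    have rt: "r \<in> S" "t \<in> S" "R t \<noteq> R r"
      using insert.prems insert.hyps t by (auto simp: inj_on_def)
    then obtain s where s: "s \<in> S" "\<theta> t s \<noteq> \<theta> r s"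
      using component_eq_iff_row_eq by blast
    obtain c where c: "c \<in> R s" "c \<noteq> 0"
      using obtain_nonzero s(1) by blast
    have swap: "a u ** c = mat_smult (\<theta> u s) (c ** a u)" if "u \<in> insert r T" for u
      using that insert.prems s c by (intro comm) auto
    define b where "b u = mat_smult (\<theta> u s - \<theta> r s) (a u)" for u
    have "c ** (\<Sum>u\<in>insert r T. b u)
        = (\<Sum>u\<in>insert r T. a u ** c) - mat_smult (\<theta> r s) (c ** (\<Sum>u\<in>insert r T. a u))"
      unfolding matrix_mult_sum b_def matrix_mult_smult mat_space.scale_sum_right
        sum_subtractf[symmetric]
      by (intro sum.cong refl) (simp add: swap mat_space.scale_left_diff_distrib)
    also have "\<dots> = 0"
      unfolding sum_matrix_mult[symmetric] insert.prems(4)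
      by (simp add: matrix_mult_zero_left matrix_mult_zero_right)
    finally have "c ** (\<Sum>u\<in>T. b u) = 0"
      using insert.hyps by (simp add: b_def)
    then have "c ** (\<Sum>u\<in>T. b u) = c ** 0"
      by (simp add: matrix_mult_zero_right)
    then have "(\<Sum>u\<in>T. b u) = 0"
      by (rule invertible_matrix_mult_left_cancel[OF homogeneous_invertible[OF s(1) c]])
    moreover have "b u \<in> R u" if "u \<in> T" for u
      unfolding b_def using that insert.prems
      by (intro mat_space.subspace_scale subspace_component) auto
    ultimately have "b t = 0"
      using insert.prems(1,2) t by (metis insert.IH inj_on_subset insert_subset subset_insertI)
    then show ?thesis
      using s(2) by (simp add: b_def)
  qed
  then have "a r = 0"
    using insert.prems(4) insert.hyps by simp
  with vanish show ?case
    using insert.prems(5) by auto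
qed

end

locale distinct_colour_decomposition = colour_decomposition S R \<theta>
  for S :: "'i set" and R :: "'i \<Rightarrow> ('k::field ^ 'n::finite ^ 'n) set" and \<theta> :: "'i \<Rightarrow> 'i \<Rightarrow> 'k" +
  assumes inj: "inj_on R S"
begin

lemma direct: "direct_family S R"
  unfolding direct_family_def
proof (intro allI impI ballI)
  fix a b i
  assume ab: "\<forall>i\<in>S. a i \<in> R i" "\<forall>i\<in>S. b i \<in> R i" "sum a S = sum b S" and i: "i \<in> S"
  have "a i - b i = 0"
    using ab i
    by (intro homogeneous_independent[OF finite_index order_refl inj, of "\<lambda>i. a i - b i"])
       (auto simp: sum_subtractf intro: mat_space.subspace_diff subspace_component)
  then show "a i = b i"
    by simp
qed

text \<open>
  The components of \<open>A\<close> along the decomposition are eigenvectors themselves. By directness, comparing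
  the eigenvalue equation of \<open>A\<close> with those of its components shows that every nonzero component of
  \<open>A\<close> has the character of \<open>A\<close>; hence \<open>A\<close> lies in the eigenspace \<open>R k\<close> of one of them.
\<close>

lemma character_occurs:
  assumes A: "A \<noteq> 0" "has_character A \<alpha>"
  obtains k where "k \<in> S" "A \<in> R k"
proof -
  obtain a where a: "\<And>i. i \<in> S \<Longrightarrow> a i \<in> R i" "A = (\<Sum>i\<in>S. a i)"
    using obtain_components[of A] by blast
  obtain k where k: "k \<in> S" "a k \<noteq> 0"
    using A(1) a(2) by (metis sum.neutral)
  have "\<theta> k s = \<alpha> s" if s: "s \<in> S" for s
  proof -
    obtain c where c: "c \<in> R s" "c \<noteq> 0"
      using obtain_nonzero s by blast
    have "c ** (\<Sum>i\<in>S. mat_smult (\<theta> i s) (a i)) = A ** c"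
      unfolding a(2) matrix_mult_sum sum_matrix_mult matrix_mult_smult
      using a(1) s c by (intro sum.cong refl comm[symmetric]) auto
    also have "\<dots> = c ** (\<Sum>i\<in>S. mat_smult (\<alpha> s) (a i))"
      using A(2) s c by (simp add: has_character_def a(2) matrix_mult_smult flip: mat_space.scale_sum_right)
    finally have "(\<Sum>i\<in>S. mat_smult (\<theta> i s) (a i)) = (\<Sum>i\<in>S. mat_smult (\<alpha> s) (a i))"
      by (rule invertible_matrix_mult_left_cancel[OF homogeneous_invertible[OF s c]])
    moreover have "mat_smult \<gamma> (a i) \<in> R i" if "i \<in> S" for \<gamma> i
      using that a(1) by (simp add: mat_space.subspace_scale subspace_component)
    ultimately have "mat_smult (\<theta> k s) (a k) = mat_smult (\<alpha> s) (a k)"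
      using direct[unfolded direct_family_def, rule_format,
          of "\<lambda>i. mat_smult (\<theta> i s) (a i)" "\<lambda>i. mat_smult (\<alpha> s) (a i)" k] k(1)
      by simp
    then show ?thesis
      using k(2) by simp
  qed
  then have "has_character A (\<theta> k)"
    using A(2) has_character_cong by blast
  then show thesis
    using that k(1) component_iff_character by blast
qed

text \<open>
  One nonzero vector from each component gives a basis of the algebra: the vectors span because the
  components are lines, and eigenvectors for different rows are independent.
\<close>

lemma card_index: "card S = CARD('n)\<^sup>2"
proof -
  have "\<forall>i\<in>S. \<exists>a. a \<in> R i \<and> a \<noteq> 0"
    using obtain_nonzero by metis
  then obtain x where x: "\<And>i. i \<in> S \<Longrightarrow> x i \<in> R i" "\<And>i. i \<in> S \<Longrightarrow> x i \<noteq> 0"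
    by metis
  have inj_x: "inj_on x S"
    using x inj components_eq_if_common_element unfolding inj_on_def by metis
  have "mat_space.dim (UNIV :: ('k ^ 'n ^ 'n) set) = card S"
  proof (rule mat_space.dim_unique)
    show "UNIV \<subseteq> mat_space.span (x ` S)"
    proof
      fix A :: "'k ^ 'n ^ 'n"
      obtain a where a: "\<And>i. i \<in> S \<Longrightarrow> a i \<in> R i" "A = (\<Sum>i\<in>S. a i)"
        using obtain_components[of A] by blast
      have "a i \<in> mat_space.span (x ` S)" if i: "i \<in> S" for i
      proof -
        obtain c where "a i = mat_smult c (x i)"
          using scalar_multiple_if_same_character i x a(1) has_character_homogeneous by metis
        then show ?thesis
          using i by (simp add: mat_space.span_base mat_space.span_scale)
      qed
      then show "A \<in> mat_space.span (x ` S)"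
        unfolding a(2) by (rule mat_space.span_sum)
    qed
    show "mat_space.independent (x ` S)"
    proof (rule mat_space.independent_if_scalars_zero)
      fix f y
      assume 0: "(\<Sum>y\<in>x ` S. mat_smult (f y) y) = 0" and "y \<in> x ` S"
      then obtain i where i: "i \<in> S" "y = x i"
        by blast
      have "mat_smult (f (x i)) (x i) = 0"
        using 0 i(1) x(1) inj_x
        by (intro homogeneous_independent[OF finite_index order_refl inj,
              of "\<lambda>i. mat_smult (f (x i)) (x i)"])
           (auto simp: sum.reindex intro: mat_space.subspace_scale subspace_component)
      then show "f y = 0"
        using i x(2) by simp
    qed (simp add: finite_index)
    show "card (x ` S) = card S"
      using inj_x by (rule card_image)
  qed simp
  then show ?thesis
    by (simp add: dim_matrix_space)
qed

lemma index_unique: "i \<in> S \<Longrightarrow> j \<in> S \<Longrightarrow> a \<in> R i \<Longrightarrow> a \<in> R j \<Longrightarrow> a \<noteq> 0 \<Longrightarrow> i = j"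
  using components_eq_if_common_element inj by (metis inj_on_def)

text \<open>
  Characters multiply, so one nonzero product determines the component that receives all products.
\<close>

lemma product_homogeneous:
  assumes "i \<in> S" "j \<in> S"
  obtains k where "k \<in> S" "\<And>a b. a \<in> R i \<Longrightarrow> b \<in> R j \<Longrightarrow> a ** b \<in> R k"
proof -
  obtain a b where ab: "a \<in> R i" "a \<noteq> 0" "b \<in> R j" "b \<noteq> 0"
    using assms obtain_nonzero by metis
  have char: "has_character (a' ** b') (\<lambda>s. \<theta> i s * \<theta> j s)" if "a' \<in> R i" "b' \<in> R j" for a' b'
    using assms that by (intro has_character_mult has_character_homogeneous)
  have inv: "invertible (a ** b)"
    using assms ab by (intro invertible_mult homogeneous_invertible[of i a] homogeneous_invertible[of j b])
  then obtain k where k: "k \<in> S" "a ** b \<in> R k"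
    using character_occurs char ab invertible_nonzero by metis
  have "\<theta> i s * \<theta> j s = \<theta> k s" if "s \<in> S" for s
    using character_unique[OF inv char has_character_homogeneous] ab k that by blast
  then have "has_character A (\<lambda>s. \<theta> i s * \<theta> j s) \<longleftrightarrow> has_character A (\<theta> k)" for A
    by (rule has_character_cong)
  then have "a' ** b' \<in> R k" if "a' \<in> R i" "b' \<in> R j" for a' b'
    using char[OF that] component_iff_character[OF k(1)] by simp
  with k(1) show thesis
    by (rule that)
qed

definition index_mult :: "'i \<Rightarrow> 'i \<Rightarrow> 'i" where
  "index_mult i j = (SOME k. k \<in> S \<and> (\<forall>a\<in>R i. \<forall>b\<in>R j. a ** b \<in> R k))"

definition index_one :: 'i where
  "index_one = (SOME e. e \<in> S \<and> mat 1 \<in> R e)"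

lemma index_mult:
  assumes "i \<in> S" "j \<in> S"
  shows index_mult_closed: "index_mult i j \<in> S"
    and matrix_mult_component: "a \<in> R i \<Longrightarrow> b \<in> R j \<Longrightarrow> a ** b \<in> R (index_mult i j)"
proof -
  have "\<exists>k. k \<in> S \<and> (\<forall>a\<in>R i. \<forall>b\<in>R j. a ** b \<in> R k)"
    using product_homogeneous[OF assms] by metis
  then have *: "index_mult i j \<in> S \<and> (\<forall>a\<in>R i. \<forall>b\<in>R j. a ** b \<in> R (index_mult i j))"
    unfolding index_mult_def by (rule someI_ex)
  then show "index_mult i j \<in> S" by simp
  show "a ** b \<in> R (index_mult i j)" if "a \<in> R i" "b \<in> R j"
    using * that by simp
qed

lemma invertible_one: "invertible (mat 1 :: 'k ^ 'n ^ 'n)"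
  by (auto simp: invertible_def intro: exI[of _ "mat 1"])

lemma index_one: shows index_one_closed: "index_one \<in> S" and one_component: "mat 1 \<in> R index_one"
proof -
  have "\<exists>e. e \<in> S \<and> mat 1 \<in> R e"
    using character_occurs has_character_one invertible_nonzero[OF invertible_one] by metis
  then have "index_one \<in> S \<and> mat 1 \<in> R index_one"
    unfolding index_one_def by (rule someI_ex)
  then show "index_one \<in> S" "mat 1 \<in> R index_one"
    by simp_all
qed

lemma index_multI:
  assumes "i \<in> S" "j \<in> S" "k \<in> S" "a \<in> R i" "b \<in> R j" "a ** b \<in> R k" "a ** b \<noteq> 0"
  shows "index_mult i j = k"
  using assms index_unique index_mult_closed matrix_mult_component by metis

lemma obtain_invertible:
  assumes "i \<in> S"
  obtains a where "a \<in> R i" "invertible a"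
  using obtain_nonzero homogeneous_invertible assms by metis

definition index_group :: "'i monoid" where
  "index_group = \<lparr>carrier = S, monoid.mult = index_mult, one = index_one\<rparr>"

lemma index_group_simps [simp]:
  "carrier index_group = S" "i \<otimes>\<^bsub>index_group\<^esub> j = index_mult i j" "\<one>\<^bsub>index_group\<^esub> = index_one"
  by (simp_all add: index_group_def)

text \<open>
  Each group law is checked on one nonzero product of representatives, since a nonzero matrix lies
  in at most one component. The inverse of \<open>i\<close> is the component of the inverse of a representative,
  whose character is the pointwise inverse of \<open>\<theta> i\<close>.
\<close>

lemma comm_group_index_group: "comm_group index_group"
proof (rule comm_groupI; simp only: index_group_simps)
  fix i j k assume ijk: "i \<in> S" "j \<in> S" "k \<in> S"
  obtain a b c where a: "a \<in> R i" "invertible a" and b: "b \<in> R j" "invertible b"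
      and c: "c \<in> R k" "invertible c"
    using ijk obtain_invertible by metis
  have "a ** b \<in> R (index_mult i j)"
    using ijk a b by (intro matrix_mult_component)
  moreover have "(a ** b) ** c \<in> R (index_mult i (index_mult j k))"
    unfolding matrix_mul_assoc[symmetric]
    using ijk a b c by (intro matrix_mult_component index_mult_closed)
  ultimately show "index_mult (index_mult i j) k = index_mult i (index_mult j k)"
    using ijk a b c
    by (intro index_multI[of _ _ _ "a ** b" c] index_mult_closed invertible_nonzero invertible_mult)
next
  fix i j assume ij: "i \<in> S" "j \<in> S"
  obtain a b where a: "a \<in> R i" "invertible a" and b: "b \<in> R j" "invertible b"
    using ij obtain_invertible by metis
  have "a ** b = mat_smult (\<theta> i j) (b ** a)"
    using ij a b by (intro comm)
  also have "\<dots> \<in> R (index_mult j i)"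
    using ij a b
    by (intro mat_space.subspace_scale subspace_component index_mult_closed matrix_mult_component)
  finally show "index_mult i j = index_mult j i"
    using ij a b
    by (intro index_multI[of _ _ _ a b] index_mult_closed invertible_nonzero invertible_mult)
next
  fix i assume i: "i \<in> S"
  obtain a where a: "a \<in> R i" "invertible a"
    using i obtain_invertible by metis
  show "index_mult index_one i = i"
    using i a index_one
    by (intro index_multI[of _ _ _ "mat 1" a]) (auto dest: invertible_nonzero)
  obtain b where b: "a ** b = mat 1" "b ** a = mat 1"
    using a(2) by (auto simp: invertible_def)
  have "has_character b (\<lambda>s. inverse (\<theta> i s))"
    by (rule has_character_inverse[OF has_character_homogeneous[OF i a(1)] b(1) theta_nonzero[OF i]])
  moreover have "b \<noteq> 0"
    using b invertible_nonzero[of b] by (auto simp: invertible_def)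
  ultimately obtain j where j: "j \<in> S" "b \<in> R j"
    using character_occurs by blast
  have "index_mult j i = index_one"
    using i j a b index_one invertible_nonzero[OF invertible_one]
    by (intro index_multI[of _ _ _ b a]) auto
  with j(1) show "\<exists>j\<in>S. index_mult j i = index_one"
    by blast
qed (simp_all add: index_mult_closed index_one_closed)

lemma direct_sum_decomposition: "direct_sum_decomposition S R"
  by (simp add: direct_sum_decomposition_def decomp direct)

lemma regular_grading: "regular_grading index_group R"
  unfolding regular_grading_def index_group_simps
proof (intro conjI ballI allI impI)
  show "direct_sum_decomposition S R"
    by (rule direct_sum_decomposition)
next
  fix i j a b assume "i \<in> S" "j \<in> S" "a \<in> R i" "b \<in> R j"
  then show "a ** b \<in> R (index_mult i j)"
    by (rule matrix_mult_component)
next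
  fix gs assume gs: "set gs \<subseteq> S"
  have "\<forall>i\<in>S. \<exists>a. a \<in> R i \<and> invertible a"
    using obtain_invertible by metis
  then obtain x where x: "\<And>i. i \<in> S \<Longrightarrow> x i \<in> R i" "\<And>i. i \<in> S \<Longrightarrow> invertible (x i)"
    by metis
  have "list_all2 (\<lambda>a g. a \<in> R g) (map x gs) gs"
    using gs x(1) by (auto simp: list_all2_map1 list_all2_same)
  moreover have "invertible (foldr (**) (map x gs) (mat 1))"
    using gs x(2) by (intro invertible_foldr_mult) auto
  ultimately show "\<exists>as. list_all2 (\<lambda>a g. a \<in> R g) as gs \<and> foldr (**) as (mat 1) \<noteq> 0"
    using invertible_nonzero by blast
next
  fix i j assume "i \<in> S" "j \<in> S"
  then show "\<exists>\<beta>. \<beta> \<noteq> 0 \<and> (\<forall>a\<in>R i. \<forall>b\<in>R j. a ** b = mat_smult \<beta> (b ** a))"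
    using comm theta_nonzero by blast
qed

lemma is_regular_group_grading: "is_regular_group_grading S R"
  unfolding is_regular_group_grading_def
  using comm_group_index_group finite_index regular_grading
  by (intro exI[of _ index_group] exI[of _ id]) simp

end

section \<open>Discarding repeated components\<close>

context colour_decomposition
begin

text \<open>
  The summands that belong to equal components are collected at the chosen index.
\<close>

lemma sum_decomposition_transversal:
  assumes T: "T \<subseteq> S" "R ` T = R ` S"
  shows "sum_decomposition T R"
  unfolding sum_decomposition_def
proof (intro conjI ballI allI)
  show "finite T"
    using T(1) finite_index by (rule finite_subset)
  show "mat_space.subspace (R t)" if "t \<in> T" for t
    using that T(1) subspace_component by blast
  fix A
  obtain a where a: "\<And>i. i \<in> S \<Longrightarrow> a i \<in> R i" "A = (\<Sum>i\<in>S. a i)"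
    using obtain_components[of A] by blast
  have "\<forall>i\<in>S. \<exists>t\<in>T. R t = R i"
    using T(2) by (metis imageE imageI)
  then obtain r where r: "\<And>i. i \<in> S \<Longrightarrow> r i \<in> T" "\<And>i. i \<in> S \<Longrightarrow> R (r i) = R i"
    by metis
  define a' where "a' t = (\<Sum>i\<in>{i\<in>S. r i = t}. a i)" for t
  have "a' t \<in> R t" if "t \<in> T" for t
    unfolding a'_def using that T(1) a(1) r(2)
    by (intro mat_space.subspace_sum subspace_component) auto
  moreover have "A = (\<Sum>t\<in>T. a' t)"
    unfolding a(2) a'_def using \<open>finite T\<close> finite_index r(1)
    by (intro sum.group[symmetric]) auto
  ultimately show "\<exists>a. (\<forall>t\<in>T. a t \<in> R t) \<and> A = (\<Sum>t\<in>T. a t)"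
    by blast
qed

lemma distinct_colour_decomposition_transversal:
  assumes T: "T \<subseteq> S" "inj_on R T" "R ` T = R ` S"
  shows "distinct_colour_decomposition T R \<theta>"
  using T nontrivial theta_nonzero comm sum_decomposition_transversal[OF T(1,3)]
  by unfold_locales (simp_all add: subset_iff)

end

theorem theorem52:
  fixes R :: "nat \<Rightarrow> ('k::alg_closed_field ^ 'n::finite ^ 'n) set"
    and \<theta> :: "nat \<Rightarrow> nat \<Rightarrow> 'k"
    and l :: nat
  assumes char: "CHAR('k) \<noteq> 2"
    and decomp: "sum_decomposition {1..l} R"
    and nonzero: "\<And>i. i \<in> {1..l} \<Longrightarrow> R i \<noteq> {0}"
    and root_of_unity: "\<And>i j. i \<in> {1..l} \<Longrightarrow> j \<in> {1..l} \<Longrightarrow> \<exists>m>0. \<theta> i j ^ m = 1"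
    and comm: "\<And>i j a b. i \<in> {1..l} \<Longrightarrow> j \<in> {1..l} \<Longrightarrow> a \<in> R i \<Longrightarrow> b \<in> R j \<Longrightarrow>
                 a ** b = mat_smult (\<theta> i j) (b ** a)"
  shows
    "(direct_family {1..l} R \<longrightarrow>
        l = CARD('n)\<^sup>2 \<and> is_regular_group_grading {1..l} R) \<and>
     (\<not> direct_family {1..l} R \<longrightarrow>
        (\<exists>I \<subseteq> {1..l}.
           (\<forall>j \<in> {1..l} - I. \<exists>k\<in>I. R j = R k) \<and>
           direct_sum_decomposition I R \<and>
           card I = CARD('n)\<^sup>2 \<and>
           is_regular_group_grading I R)) \<and>
     CARD('n)\<^sup>2 = mat_space.dim (UNIV :: ('k ^ 'n ^ 'n) set) \<and>
     mat_space.dim (UNIV :: ('k ^ 'n ^ 'n) set) =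
       card ((\<lambda>i. restrict (\<theta> i) {1..l}) ` {1..l})"
proof -
  interpret colour_decomposition "{1..l}" R \<theta>
  proof
    show "\<theta> i j \<noteq> 0" if "i \<in> {1..l}" "j \<in> {1..l}" for i j
      using root_of_unity[OF that] by (auto simp: zero_power)
  qed (fact decomp nonzero comm)+
  obtain I where I: "I \<subseteq> {1..l}" "inj_on R I" "R ` I = R ` {1..l}"
    using subset_image_inj[of "R ` {1..l}" R "{1..l}"] by auto
  interpret T: distinct_colour_decomposition I R \<theta>
    using I by (rule distinct_colour_decomposition_transversal)
  have a: "l = CARD('n)\<^sup>2 \<and> is_regular_group_grading {1..l} R" if "direct_family {1..l} R"
  proof -
    interpret D: distinct_colour_decomposition "{1..l}" R \<theta>
      by (rule distinct_colour_decomposition_transversal[OF order_refl inj_on_if_direct[OF that] refl])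
    show ?thesis
      using D.card_index D.is_regular_group_grading by simp
  qed
  have "\<forall>j \<in> {1..l} - I. \<exists>k\<in>I. R j = R k"
    using I(3) by (metis DiffD1 imageE imageI)
  then have b: "\<exists>I \<subseteq> {1..l}. (\<forall>j \<in> {1..l} - I. \<exists>k\<in>I. R j = R k) \<and> direct_sum_decomposition I R \<and>
      card I = CARD('n)\<^sup>2 \<and> is_regular_group_grading I R"
    using I(1) T.direct_sum_decomposition T.card_index T.is_regular_group_grading by blast
  have "card ((\<lambda>i. restrict (\<theta> i) {1..l}) ` {1..l}) = card I"
    unfolding card_rows_eq_card_components I(3)[symmetric] using I(2) by (rule card_image)
  then show ?thesis
    using a b T.card_index by (simp add: dim_matrix_space)
qed

end
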